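(* Let $G$ be a finite abelian group of order $N$, let $S\subseteq G\setminus\{0\}$ satisfy $S=-S$, and let $K$ be a field. The spectral algebra $\mathcal{A}_K(\mathrm{Cay}(G,S))$ is a subalgebra of the Bose--Mesner algebra $\mathcal{M}$ of the Cayley association scheme on $G$. Specifically, $A=\sum_{s\in S}P_s\in\mathcal{M}$, so $\mathcal{A}_K(\mathrm{Cay}(G,S))=K[A]\subseteq\mathcal{M}$. In general $\mathcal{A}_K(\mathrm{Cay}(G,S))\subsetneq\mathcal{M}$: the complete Cayley graph $\mathrm{Cay}(G,G\setminus\{0\})$ has only two distinct eigenvalues $N-1$ and $-1$, giving $\mathcal{A}_K(\mathrm{Cay}(G,G\setminus\{0\}))\cong K^2$, which has dimension $2\ll N=\dim_K\mathcal{M}$. To generate all of $\mathcal{M}$ one needs all $N$ translation matrices $\{P_g:g\in G\}$, not just the single adjacency-matrix sum $\sum_{s\in S}P_s$.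
   Context: $G$ is written additively. $\mathrm{Cay}(G,S)$ is the graph with vertex set $G$ and edges $\{g,g+s\}$ for $g\in G$, $s\in S$; its adjacency matrix $A$, with rows and columns indexed by $G$, has $A_{g,h}=1$ if $h-g\in S$ and $0$ otherwise, regarded as a matrix over $K$. The spectral algebra is $\mathcal{A}_K(\mathrm{Cay}(G,S))=K[A]=\{f(A):f\in K[x]\}\subseteq M_N(K)$. For $g\in G$, $P_g\in M_N(K)$ is the translation matrix with $(P_g)_{h,h'}=1$ if $h'=h+g$ and $0$ otherwise. The Cayley association scheme on $G$ has classes $R_s=\{(g,g+s):g\in G\}$ for $s\in G$, and its Bose--Mesner algebra is $\mathcal{M}=K[P_g:g\in G]\subseteq M_N(K)$, the full commutative $K$-algebra generated by all translation matrices.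
   Formalization: For the complete graph, the eigenvalue set and dimension 2 assume N≥2; distinctness of the eigenvalues and K[A]≅K² also need N≠0 in K (else (A+I)²=0). Strict inclusion in M assumes N≥3. Needing all N translation matrices to generate M is read as linear spanning. *)

theory Defs
  imports "HOL-Analysis.Analysis" "HOL-Computational_Algebra.Polynomial"
begin

text \<open>
  The finite abelian group G is a type of class \<open>{finite, ab_group_add}\<close>, the field K is a
  type \<open>'k\<close> of class \<open>field\<close>, and matrices over K with rows and columns indexed by G have type
  \<open>('k, 'g) sqmat\<close>, i.e. \<open>'k^'g^'g\<close>. On this type \<open>*\<close> and \<open>^\<close> are entrywise; the matrix product is \<open>**\<close>, and scalar
  multiplication and powers of matrices over a general field are defined here.
\<close>

type_synonym ('k, 'n) sqmat = "(('k, 'n) vec, 'n) vec"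

definition mscale :: "'k::field \<Rightarrow> 'k^'m^'n \<Rightarrow> 'k^'m^'n"  (infixr \<open>*m\<close> 75)
  where "c *m X = (\<chi> i j. c * X $ i $ j)"

interpretation mat_space: vector_space "mscale :: 'k::field \<Rightarrow> 'k^'m^'n \<Rightarrow> 'k^'m^'n"
  by unfold_locales (auto simp: mscale_def vec_eq_iff algebra_simps)

definition mat_pow :: "('k::field, 'n::finite) sqmat \<Rightarrow> nat \<Rightarrow> ('k, 'n::finite) sqmat"
  where "mat_pow X n = (((**) X) ^^ n) (mat 1)"

definition poly_mat :: "'k::field poly \<Rightarrow> ('k, 'n::finite) sqmat \<Rightarrow> ('k, 'n::finite) sqmat"
  where "poly_mat f X = (\<Sum>i\<le>degree f. coeff f i *m mat_pow X i)"

definition mat_eigenvalue :: "('k::field, 'n::finite) sqmat \<Rightarrow> 'k \<Rightarrow> bool"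
  where "mat_eigenvalue X c \<longleftrightarrow> (\<exists>v. v \<noteq> 0 \<and> X *v v = c *s v)"

definition is_subalgebra :: "('k::field, 'n::finite) sqmat set \<Rightarrow> bool"
  where "is_subalgebra B \<longleftrightarrow>
    mat_space.subspace B \<and> mat 1 \<in> B \<and> (\<forall>X\<in>B. \<forall>Y\<in>B. X ** Y \<in> B)"

definition gen_algebra :: "('k::field, 'n::finite) sqmat set \<Rightarrow> ('k, 'n::finite) sqmat set"
  where "gen_algebra X = is_subalgebra hull X"

text \<open>
  Isomorphism of unital K-algebras from a matrix algebra \<open>B\<close> onto \<open>K\<^sup>2\<close>; on \<open>'k^2\<close> the ring
  operations \<open>+\<close>, \<open>*\<close>, \<open>1\<close> are componentwise.
\<close>

definition is_iso_to_K2 :: "(('k::field, 'n::finite) sqmat \<Rightarrow> 'k^2) \<Rightarrow> ('k, 'n::finite) sqmat set \<Rightarrow> bool"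
  where "is_iso_to_K2 \<phi> B \<longleftrightarrow>
    bij_betw \<phi> B UNIV \<and> \<phi> (mat 1) = 1 \<and>
    (\<forall>X\<in>B. \<forall>Y\<in>B. \<phi> (X + Y) = \<phi> X + \<phi> Y \<and> \<phi> (X ** Y) = \<phi> X * \<phi> Y) \<and>
    (\<forall>c. \<forall>X\<in>B. \<phi> (c *m X) = c *s \<phi> X)"

definition cay_edges :: "'g::ab_group_add set \<Rightarrow> 'g set set"
  where "cay_edges S = {{g, g + s} | g s. s \<in> S}"

definition cay_adj :: "'g::{finite,ab_group_add} set \<Rightarrow> ('k::field, 'g::{finite,ab_group_add}) sqmat"
  where "cay_adj S = (\<chi> g h. if h - g \<in> S then 1 else 0)"

lemma cay_adj_edges:
  assumes "uminus ` S = S"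
  shows "(cay_adj S :: ('k::field, 'g::{finite,ab_group_add}) sqmat) $ g $ h =
    (if {g, h} \<in> cay_edges S then 1 else 0)"
proof -
  have "{g, h} \<in> cay_edges S \<longleftrightarrow> h - g \<in> S"
  proof
    assume "{g, h} \<in> cay_edges S"
    then obtain a s where s: "s \<in> S" and e: "{g, h} = {a, a + s}"
      by (auto simp: cay_edges_def)
    from e consider "g = a" "h = a + s" | "h = a" "g = a + s"
      by (auto simp: doubleton_eq_iff)
    then show "h - g \<in> S"
      using s assms by cases (auto simp: algebra_simps)
  next
    assume "h - g \<in> S"
    moreover have "{g, h} = {g, g + (h - g)}" by simp
    ultimately show "{g, h} \<in> cay_edges S"
      unfolding cay_edges_def by blast
  qed
  then show ?thesis by (simp add: cay_adj_def)
qed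

definition spectral_algebra :: "('k::field, 'n::finite) sqmat \<Rightarrow> ('k, 'n::finite) sqmat set"
  where "spectral_algebra X = {poly_mat f X | f. True}"

definition cay_spectral :: "'g::{finite,ab_group_add} set \<Rightarrow> ('k::field, 'g::{finite,ab_group_add}) sqmat set"
  where "cay_spectral S = spectral_algebra (cay_adj S)"

definition translation_mat :: "'g::{finite,ab_group_add} \<Rightarrow> ('k::field, 'g::{finite,ab_group_add}) sqmat"
  where "translation_mat g = (\<chi> h h'. if h' = h + g then 1 else 0)"

definition cay_class :: "'g::ab_group_add \<Rightarrow> ('g \<times> 'g) set"
  where "cay_class s = {(g, g + s) | g. True}"

lemma translation_mat_class:
  "(translation_mat s :: ('k::field, 'g::{finite,ab_group_add}) sqmat) $ g $ h =
    (if (g, h) \<in> cay_class s then 1 else 0)"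
  by (auto simp: translation_mat_def cay_class_def)

definition bose_mesner :: "('k::field, 'g::{finite,ab_group_add}) sqmat set"
  where "bose_mesner = gen_algebra (range translation_mat)"

end

theory Submission
  imports Defs
begin

text \<open>
  \<open>K[A]\<close> is the span of the powers of \<open>A\<close>, and \<open>\<M>\<close> has the translation matrices as a basis, since
  they are determined by their rows at \<open>0\<close>. Strictness of \<open>K[A] \<subset> \<M>\<close> for \<open>N \<ge> 3\<close> has two reasons. If
  some \<open>g \<noteq> -g\<close>, then every element of \<open>K[A]\<close> is a symmetric matrix but \<open>P\<^sub>g\<close> is not. Otherwise each \<open>P\<^sub>s\<close>
  is an involution, and the elementary symmetric polynomials \<open>e\<^sub>k\<close> in the \<open>m = |S|\<close> matrices \<open>P\<^sub>s\<close>,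
  \<open>s \<in> S\<close>, satisfy \<open>A e\<^sub>k = (k + 1) e\<^bsub>k+1\<^esub> + (m - k + 1) e\<^bsub>k-1\<^esub>\<close> in every characteristic. So
  \<open>e\<^sub>0, \<dots>, e\<^sub>m\<close> span a space containing \<open>K[A]\<close>, whose dimension is thus at most \<open>m + 1\<close>; this is less
  than \<open>N\<close> unless \<open>S = G - {0}\<close>, where \<open>A\<^sup>2 = (N - 2) A + (N - 1)\<close> gives dimension at most \<open>2\<close>.
\<close>

section \<open>Matrix algebras over a field\<close>

lemma mscale_nth [simp]: "(c *m X) $ i $ j = c * X $ i $ j"
  by (simp add: mscale_def)

lemma mscale_matrix_mult_left: "(c *m X) ** Y = c *m (X ** Y)"
  by (simp add: vec_eq_iff matrix_matrix_mult_def sum_distrib_left mult_ac)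

lemma mscale_matrix_mult_right: "X ** (c *m Y) = c *m (X ** Y)"
  by (simp add: vec_eq_iff matrix_matrix_mult_def sum_distrib_left mult_ac)

lemma matrix_add_rdistrib:
  fixes X Y :: "'a::semiring_1^'n^'m"
  shows "(X + Y) ** Z = X ** Z + Y ** Z"
  by (simp add: vec_eq_iff matrix_matrix_mult_def distrib_right sum.distrib)

text \<open>Left multiplication by \<open>X\<close> is linear, so invariance of a span need only be
  checked on generators.\<close>

lemma matrix_mult_in_span:
  fixes X :: "('k::field, 'n::finite) sqmat"
  assumes gen: "\<And>Y. Y \<in> W \<Longrightarrow> X ** Y \<in> mat_space.span V"
    and Y: "Y \<in> mat_space.span W"
  shows "X ** Y \<in> mat_space.span V"
  using Y
proof (induction rule: mat_space.span_induct_alt)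
  case base
  have "X ** 0 = 0"
    by (simp add: vec_eq_iff matrix_matrix_mult_def)
  then show ?case
    by (metis mat_space.span_zero)
next
  case (step c Z Y)
  then show ?case
    by (metis gen matrix_add_ldistrib mscale_matrix_mult_right mat_space.span_add mat_space.span_scale)
qed

lemma matrix_mult_in_span_left:
  fixes X :: "('k::field, 'n::finite) sqmat"
  assumes gen: "\<And>Y. Y \<in> W \<Longrightarrow> Y ** X \<in> mat_space.span V"
    and Y: "Y \<in> mat_space.span W"
  shows "Y ** X \<in> mat_space.span V"
  using Y
proof (induction rule: mat_space.span_induct_alt)
  case base
  have "0 ** X = 0"
    by (simp add: vec_eq_iff matrix_matrix_mult_def)
  then show ?case
    by (metis mat_space.span_zero)
next
  case (step c Z Y)
  then show ?case
    by (metis gen matrix_add_rdistrib mscale_matrix_mult_left mat_space.span_add mat_space.span_scale)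
qed

lemma is_subalgebra_span:
  assumes one: "mat 1 \<in> W"
    and mult: "\<And>X Y. X \<in> W \<Longrightarrow> Y \<in> W \<Longrightarrow> X ** Y \<in> W"
  shows "is_subalgebra (mat_space.span W)"
proof -
  have "X ** Y \<in> mat_space.span W" if "X \<in> W" "Y \<in> mat_space.span W" for X Y
    using matrix_mult_in_span[of W X W Y] that by (auto intro: mat_space.span_base mult)
  then have "X ** Y \<in> mat_space.span W" if "X \<in> mat_space.span W" "Y \<in> mat_space.span W" for X Y
    using matrix_mult_in_span_left[of W Y W X] that by auto
  then show ?thesis
    using one by (auto simp: is_subalgebra_def intro: mat_space.span_base)
qed

text \<open>A set closed under products and containing the identity already holds every monomial in
  its elements, so linear combinations alone give the generated algebra.\<close>

lemma gen_algebra_eq_span: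
  assumes one: "mat 1 \<in> W"
    and mult: "\<And>X Y. X \<in> W \<Longrightarrow> Y \<in> W \<Longrightarrow> X ** Y \<in> W"
  shows "gen_algebra W = mat_space.span W"
proof -
  have "mat_space.span W \<subseteq> B" if "W \<subseteq> B" "is_subalgebra B" for B
    using that by (intro mat_space.span_minimal) (auto simp: is_subalgebra_def)
  then show ?thesis
    unfolding gen_algebra_def
    by (intro hull_unique) (auto intro: mat_space.span_base is_subalgebra_span assms)
qed

section \<open>Polynomials in a single matrix\<close>

lemma mat_pow_0 [simp]: "mat_pow X 0 = mat 1"
  and mat_pow_Suc: "mat_pow X (Suc n) = X ** mat_pow X n"
  by (simp_all add: mat_pow_def)

lemma mat_pow_add: "mat_pow X (m + n) = mat_pow X m ** mat_pow X n"
  by (induction m) (simp_all add: mat_pow_Suc matrix_mul_assoc)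

text \<open>Padding with zero coefficients up to a common bound lets polynomials of different
  degrees be added term by term.\<close>

lemma poly_mat_eq_sum:
  assumes "degree f \<le> n"
  shows "poly_mat f X = (\<Sum>i\<le>n. coeff f i *m mat_pow X i)"
  unfolding poly_mat_def
proof (rule sum.mono_neutral_left)
  show "\<forall>i\<in>{..n} - {..degree f}. coeff f i *m mat_pow X i = 0"
    by (auto simp: coeff_eq_0)
qed (use assms in auto)

lemma spectral_algebra_eq_span: "spectral_algebra X = mat_space.span (range (mat_pow X))"
proof
  have "poly_mat f X \<in> mat_space.span (range (mat_pow X))" for f
    unfolding poly_mat_def
    by (intro mat_space.span_sum mat_space.span_scale mat_space.span_base rangeI)
  then show "spectral_algebra X \<subseteq> mat_space.span (range (mat_pow X))"
    by (auto simp: spectral_algebra_def)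
  have mem: "poly_mat f X \<in> spectral_algebra X" for f
    by (auto simp: spectral_algebra_def)
  have "mat_space.subspace (spectral_algebra X)"
  proof (rule mat_space.subspaceI)
    have "poly_mat 0 X = 0"
      by (simp add: poly_mat_def)
    then show "0 \<in> spectral_algebra X"
      by (metis mem)
  next
    fix Y Z
    assume "Y \<in> spectral_algebra X" "Z \<in> spectral_algebra X"
    then obtain f g where fg: "Y = poly_mat f X" "Z = poly_mat g X"
      by (auto simp: spectral_algebra_def)
    define n where "n = max (degree f) (degree g)"
    have "poly_mat (f + g) X = Y + Z"
      using poly_mat_eq_sum[of f n X] poly_mat_eq_sum[of g n X] poly_mat_eq_sum[of "f + g" n X]
      by (simp add: fg n_def degree_add_le mat_space.scale_left_distrib sum.distrib)
    then show "Y + Z \<in> spectral_algebra X"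
      by (metis mem)
  next
    fix c Y
    assume "Y \<in> spectral_algebra X"
    then obtain f where f: "Y = poly_mat f X"
      by (auto simp: spectral_algebra_def)
    have "poly_mat (smult c f) X = c *m Y"
      by (simp add: f poly_mat_eq_sum[of _ "degree f"] degree_smult_le mat_space.scale_sum_right)
    then show "c *m Y \<in> spectral_algebra X"
      by (metis mem)
  qed
  moreover have "mat_pow X n \<in> spectral_algebra X" for n
  proof -
    have "poly_mat (monom 1 n) X = (\<Sum>i\<in>{n}. coeff (monom 1 n) i *m mat_pow X i)"
      unfolding poly_mat_def by (rule sum.mono_neutral_right) (auto simp: degree_monom_eq)
    then have "poly_mat (monom 1 n) X = mat_pow X n"
      by simp
    then show ?thesis
      by (metis mem)
  qed
  ultimately show "mat_space.span (range (mat_pow X)) \<subseteq> spectral_algebra X"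
    by (intro mat_space.span_minimal) auto
qed

lemma is_subalgebra_spectral_algebra: "is_subalgebra (spectral_algebra X)"
  unfolding spectral_algebra_eq_span
proof (rule is_subalgebra_span)
  show "mat 1 \<in> range (mat_pow X)"
    by (metis mat_pow_0 rangeI)
  show "Y ** Z \<in> range (mat_pow X)" if "Y \<in> range (mat_pow X)" "Z \<in> range (mat_pow X)" for Y Z
    using that by (auto simp flip: mat_pow_add)
qed

text \<open>An \<open>X\<close>-invariant subspace containing the identity contains all powers of
  \<open>X\<close>. Every upper bound on \<open>K[A]\<close> below is obtained this way.\<close>

lemma spectral_algebra_subset:
  assumes "mat_space.subspace V" "mat 1 \<in> V" "\<And>Y. Y \<in> V \<Longrightarrow> X ** Y \<in> V"
  shows "spectral_algebra X \<subseteq> V"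
proof -
  have "mat_pow X n \<in> V" for n
    by (induction n) (auto simp: mat_pow_Suc assms)
  then show ?thesis
    unfolding spectral_algebra_eq_span
    by (intro mat_space.span_minimal assms(1)) auto
qed

lemma self_in_spectral_algebra: "X \<in> spectral_algebra X"
  and one_in_spectral_algebra: "mat 1 \<in> spectral_algebra X"
proof -
  have "mat_pow X (Suc 0) = X"
    by (simp add: mat_pow_Suc)
  then show "X \<in> spectral_algebra X"
    unfolding spectral_algebra_eq_span by (metis mat_space.span_base rangeI)
  show "mat 1 \<in> spectral_algebra X"
    unfolding spectral_algebra_eq_span by (metis mat_pow_0 mat_space.span_base rangeI)
qed

lemma spectral_algebra_symmetric:
  assumes X: "transpose X = X" and Y: "Y \<in> spectral_algebra X"
  shows "transpose Y = Y"
proof -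
  have sym: "transpose (mat_pow X n) = mat_pow X n" for n
  proof (induction n)
    case (Suc n)
    \<comment> \<open>Transposition reverses the product; the order is restored because powers of
      \<open>X\<close> commute.\<close>
    have "transpose (mat_pow X (Suc n)) = mat_pow X n ** mat_pow X 1"
      by (simp add: mat_pow_Suc matrix_transpose_mul Suc X)
    also have "\<dots> = mat_pow X (Suc n)"
      by (simp flip: mat_pow_add)
    finally show ?case .
  qed (simp add: transpose_mat)
  have "\<forall>i j. Y $ i $ j = Y $ j $ i"
    using Y unfolding spectral_algebra_eq_span
  proof (induction rule: mat_space.span_induct_alt)
    case (step c Z Y)
    then show ?case
      using sym by (auto simp: transpose_def vec_eq_iff)
  qed simp
  then show ?thesis
    by (simp add: transpose_def vec_eq_iff)
qed

section \<open>The Bose-Mesner algebra\<close>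

lemma translation_mat_0: "translation_mat 0 = mat 1"
  by (auto simp: translation_mat_def mat_def vec_eq_iff)

lemma translation_mat_mult:
  fixes g h :: "'g::{finite,ab_group_add}"
  shows "(translation_mat g :: ('k::field, 'g) sqmat) ** translation_mat h = translation_mat (g + h)"
proof -
  have "(\<Sum>k\<in>UNIV. (if k = i + g then 1 else 0) * (if j = k + h then 1 else 0))
    = (if j = i + (g + h) then 1 else (0::'k))" for i j
    by (simp add: if_distrib[of "\<lambda>x. x * _"] sum.delta add.assoc cong: if_cong)
  then show ?thesis
    by (simp add: translation_mat_def matrix_matrix_mult_def vec_eq_iff)
qed

lemma bose_mesner_eq_span: "bose_mesner = mat_space.span (range translation_mat)"
  unfolding bose_mesner_def
  by (rule gen_algebra_eq_span) (auto simp: translation_mat_mult simp flip: translation_mat_0)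

text \<open>Row \<open>0\<close> of \<open>translation_mat h\<close> is the indicator of
  \<open>h\<close>, so the entry at column \<open>g\<close> reads off the coefficient of
  \<open>translation_mat g\<close>.\<close>

lemma span_translation_mat_nth_eq_0:
  assumes "X \<in> mat_space.span (translation_mat ` T)" "g \<notin> T"
  shows "X $ 0 $ g = 0"
  using assms(1)
proof (induction rule: mat_space.span_induct_alt)
  case (step c Z Y)
  then show ?case
    using assms(2) by (auto simp: translation_mat_def split: if_splits)
qed simp

lemma translation_mat_in_span_iff:
  "(translation_mat g :: ('k::field, 'g::{finite,ab_group_add}) sqmat)
    \<in> mat_space.span (translation_mat ` T) \<longleftrightarrow> g \<in> T"
proof
  assume "(translation_mat g :: ('k, 'g) sqmat) \<in> mat_space.span (translation_mat ` T)"
  then have "g \<notin> T \<Longrightarrow> (translation_mat g :: ('k, 'g) sqmat) $ 0 $ g = 0"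
    by (rule span_translation_mat_nth_eq_0)
  then show "g \<in> T"
    by (auto simp: translation_mat_def)
qed (auto intro: mat_space.span_base)

lemma inj_translation_mat: "inj (translation_mat :: 'g::{finite,ab_group_add} \<Rightarrow> ('k::field, 'g) sqmat)"
proof
  fix g h :: 'g
  assume "(translation_mat g :: ('k, 'g) sqmat) = translation_mat h"
  then have "(translation_mat g :: ('k, 'g) sqmat) \<in> mat_space.span (translation_mat ` {h})"
    by (auto intro: mat_space.span_base)
  then show "g = h"
    by (simp only: translation_mat_in_span_iff) simp
qed

lemma independent_translation_mat:
  "mat_space.independent (range translation_mat :: ('k::field, 'g::{finite,ab_group_add}) sqmat set)"
proof -
  have "range translation_mat - {translation_mat g :: ('k, 'g) sqmat} = translation_mat ` (UNIV - {g})" for g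
    by (auto simp: inj_eq[OF inj_translation_mat])
  then show ?thesis
    by (auto simp: mat_space.dependent_def translation_mat_in_span_iff)
qed

lemma card_range_translation_mat:
  "card (range translation_mat :: ('k::field, 'g::{finite,ab_group_add}) sqmat set) = CARD('g)"
  by (intro card_image inj_translation_mat)

text \<open>Steinitz exchange: the \<open>N\<close> independent translation matrices cannot lie in
  the span of fewer than \<open>N\<close> matrices. This is the dimension count behind the strict
  inclusions.\<close>

lemma bose_mesner_not_subset_span:
  fixes W :: "('k::field, 'g::{finite,ab_group_add}) sqmat set"
  assumes "finite W" "card W < CARD('g)"
  shows "\<not> bose_mesner \<subseteq> mat_space.span W"
proof
  assume "bose_mesner \<subseteq> mat_space.span W"
  then have "range translation_mat \<subseteq> mat_space.span W"
    unfolding bose_mesner_eq_span using mat_space.span_superset by blast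
  from mat_space.independent_span_bound[OF assms(1) independent_translation_mat this]
  show False
    using assms(2) by (simp add: card_range_translation_mat)
qed

section \<open>Adjacency matrices as sums of translations\<close>

lemma cay_adj_eq_sum:
  fixes S :: "'g::{finite,ab_group_add} set"
  shows "(cay_adj S :: ('k::field, 'g) sqmat) = (\<Sum>s\<in>S. translation_mat s)"
proof -
  have "(\<Sum>s\<in>S. if h = g + s then 1 else (0::'k)) = (if h - g \<in> S then 1 else 0)" for g h
  proof -
    have "h = g + s \<longleftrightarrow> h - g = s" for s
      by (auto simp: algebra_simps)
    then show ?thesis
      by (simp add: sum.delta')
  qed
  then show ?thesis
    by (simp add: vec_eq_iff cay_adj_def translation_mat_def)
qed

lemma cay_adj_in_bose_mesner: "cay_adj S \<in> bose_mesner"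
  unfolding cay_adj_eq_sum bose_mesner_eq_span
  by (auto intro: mat_space.span_sum mat_space.span_base)

lemma is_subalgebra_bose_mesner: "is_subalgebra bose_mesner"
  unfolding bose_mesner_eq_span
  by (rule is_subalgebra_span) (auto simp: translation_mat_mult simp flip: translation_mat_0)

lemma cay_spectral_subset_bose_mesner: "cay_spectral S \<subseteq> bose_mesner"
  unfolding cay_spectral_def
  using is_subalgebra_bose_mesner
  by (intro spectral_algebra_subset) (auto simp: is_subalgebra_def cay_adj_in_bose_mesner)

section \<open>The complete Cayley graph\<close>

abbreviation (input) cay_complete :: "('k::field, 'g::{finite,ab_group_add}) sqmat"
  where "cay_complete \<equiv> cay_adj (UNIV - {0})"

lemma cay_complete_nth: "cay_complete $ g $ h = (if g = h then 0 else 1)"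
  by (auto simp: cay_adj_def)

lemma cay_complete_square:
  "(cay_complete :: ('k::field, 'g::{finite,ab_group_add}) sqmat) ** cay_complete
    = (of_nat CARD('g) - 2) *m cay_complete + (of_nat CARD('g) - 1) *m mat 1"
proof -
  let ?A = "cay_complete :: ('k, 'g) sqmat"
  \<comment> \<open>The all-ones matrix \<open>J\<close> satisfies \<open>J ** J = N *m J\<close>;
    expanding this with \<open>J = A + 1\<close> gives the quadratic relation for
    \<open>A\<close>.\<close>
  have J: "?A + mat 1 = (\<chi> i j. 1)"
    by (simp add: vec_eq_iff cay_complete_nth mat_def)
  have "(?A + mat 1) ** (?A + mat 1) = of_nat CARD('g) *m (?A + mat 1)"
    unfolding J by (simp add: vec_eq_iff matrix_matrix_mult_def)
  then have "?A ** ?A + ?A + ?A + mat 1 = of_nat CARD('g) *m (?A + mat 1)"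
    by (simp add: matrix_add_ldistrib matrix_add_rdistrib add_ac)
  then show ?thesis
    by (simp add: vec_eq_iff algebra_simps eq_diff_eq)
qed

lemma span_pair:
  fixes X Y :: "('k::field, 'n::finite) sqmat"
  shows "mat_space.span {X, Y} = {x *m X + y *m Y | x y. True}"
proof -
  have "Z - x *m X = y *m Y \<longleftrightarrow> Z = x *m X + y *m Y" for x y and Z :: "('k, 'n) sqmat"
    by (simp add: diff_eq_eq add.commute)
  then show ?thesis
    by (auto simp: mat_space.span_insert[of X] mat_space.span_singleton image_iff)
qed

lemma cay_spectral_complete:
  "cay_spectral (UNIV - {0}) = mat_space.span {mat 1, cay_complete}"
proof
  show "cay_spectral (UNIV - {0}) \<subseteq> mat_space.span {mat 1, cay_complete}"
    unfolding cay_spectral_def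
  proof (rule spectral_algebra_subset)
    show "cay_complete ** Y \<in> mat_space.span {mat 1, cay_complete}"
      if "Y \<in> mat_space.span {mat 1, cay_complete}" for Y
      using that
      proof (rule matrix_mult_in_span[rotated])
        have "cay_complete ** cay_complete \<in> mat_space.span {mat 1, cay_complete}"
          unfolding cay_complete_square
          by (intro mat_space.span_add mat_space.span_scale mat_space.span_base) auto
        then show "cay_complete ** Z \<in> mat_space.span {mat 1, cay_complete}"
          if "Z \<in> {mat 1, cay_complete}" for Z
          using that by (auto intro: mat_space.span_base)
      qed
  qed (auto intro: mat_space.span_base)
  show "mat_space.span {mat 1, cay_complete} \<subseteq> cay_spectral (UNIV - {0})"
    unfolding cay_spectral_def
    using is_subalgebra_spectral_algebra
    by (intro mat_space.span_minimal)
      (auto simp: is_subalgebra_def self_in_spectral_algebra one_in_spectral_algebra)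
qed

lemma obtain_nonzero:
  assumes "CARD('g::{finite,ab_group_add}) \<ge> 2"
  obtains a :: "'g::{finite,ab_group_add}" where "a \<noteq> 0"
proof -
  have "\<not> (UNIV :: 'g set) \<subseteq> {0}"
    using card_mono[of "{0 :: 'g}" UNIV] assms by auto
  then show thesis
    using that by auto
qed

lemma dim_cay_spectral_complete:
  assumes "CARD('g::{finite,ab_group_add}) \<ge> 2"
  shows "mat_space.dim (cay_spectral (UNIV - {0}) :: ('k::field, 'g::{finite,ab_group_add}) sqmat set) = 2"
proof -
  obtain a :: 'g where a: "a \<noteq> 0"
    using obtain_nonzero assms by blast
  \<comment> \<open>The diagonal of \<open>A\<close> vanishes while that of the identity does not,
    in any characteristic.\<close>
  have "(mat 1 :: ('k, 'g) sqmat) \<noteq> c *m cay_complete" for c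
    by (auto simp: vec_eq_iff mat_def cay_complete_nth intro!: exI[of _ 0])
  moreover have "(cay_complete :: ('k, 'g) sqmat) $ 0 $ a \<noteq> 0"
    using a by (simp add: cay_complete_nth)
  then have "(cay_complete :: ('k, 'g) sqmat) \<noteq> 0"
    by force
  ultimately have "mat_space.independent {mat 1, cay_complete :: ('k, 'g) sqmat}"
    and "(mat 1 :: ('k, 'g) sqmat) \<noteq> cay_complete"
    by (auto simp: mat_space.independent_insert mat_space.span_singleton)
      (metis mat_space.scale_one)
  then show ?thesis
    by (simp add: cay_spectral_complete mat_space.dim_eq_card_independent)
qed

section \<open>Eigenvalues of the complete graph and the isomorphism onto \<open>K^2\<close>\<close>

lemma mat_eigenvalue_cay_complete:
  assumes "CARD('g::{finite,ab_group_add}) \<ge> 2"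
  shows "{c. mat_eigenvalue (cay_complete :: ('k::field, 'g::{finite,ab_group_add}) sqmat) c} = {of_nat CARD('g) - 1, -1}"
proof -
  have mv: "((cay_complete :: ('k, 'g) sqmat) *v v) $ g = (\<Sum>h\<in>UNIV. v $ h) - v $ g" for v g
  proof -
    have "((cay_complete :: ('k, 'g) sqmat) *v v) $ g = (\<Sum>h\<in>UNIV. v $ h - (if h = g then v $ h else 0))"
      by (auto simp: matrix_vector_mult_def cay_complete_nth intro!: sum.cong)
    then show ?thesis
      by (simp add: sum_subtractf)
  qed
  \<comment> \<open>Since \<open>A = J - 1\<close>, an eigenvector for \<open>c\<close> is a nonzero
    \<open>v\<close> all of whose multiples \<open>(c + 1) * v $ g\<close> equal the coordinate sum.
    The constant vector gives \<open>c = N - 1\<close>, and vectors of coordinate sum zero give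
    \<open>c = -1\<close>.\<close>
  have eig: "mat_eigenvalue (cay_complete :: ('k, 'g) sqmat) c
    \<longleftrightarrow> (\<exists>v :: ('k, 'g) vec. v \<noteq> 0 \<and> (\<forall>g. (\<Sum>h\<in>UNIV. v $ h) = (c + 1) * v $ g))" for c
    by (simp add: mat_eigenvalue_def vec_eq_iff mv diff_eq_eq algebra_simps)
  obtain a :: 'g where a: "a \<noteq> 0"
    using obtain_nonzero assms by blast
  have "mat_eigenvalue (cay_complete :: ('k, 'g) sqmat) (of_nat CARD('g) - 1)"
    unfolding eig by (rule exI[of _ 1]) (simp add: vec_eq_iff)
  moreover have "mat_eigenvalue (cay_complete :: ('k, 'g) sqmat) (- 1)"
    unfolding eig
  proof (intro exI conjI allI)
    let ?v = "(\<chi> g. (if g = 0 then 1 else 0) - (if g = a then 1 else 0)) :: ('k, 'g) vec"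
    show "?v \<noteq> 0"
      using a by (auto simp: vec_eq_iff intro!: exI[of _ 0])
    show "(\<Sum>h\<in>UNIV. ?v $ h) = (- 1 + 1) * ?v $ g" for g
      by (simp add: sum_subtractf)
  qed
  moreover have "c = of_nat CARD('g) - 1"
    if "mat_eigenvalue (cay_complete :: ('k, 'g) sqmat) c" and c: "c \<noteq> - 1" for c
  proof -
    from that obtain v :: "('k, 'g) vec" where v: "v \<noteq> 0"
      and sum: "\<And>g. (\<Sum>h\<in>UNIV. v $ h) = (c + 1) * v $ g"
      unfolding eig by blast
    \<comment> \<open>Cancelling \<open>c + 1\<close> makes \<open>v\<close> constant and nonzero;
      comparing its coordinate sum with \<open>(c + 1) * v $ 0\<close> then yields
      \<open>c + 1 = N\<close>.\<close>
    have "c + 1 \<noteq> 0"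
      using c by (simp add: add_eq_0_iff2)
    then have const: "v $ g = v $ 0" for g
      using sum[of g] sum[of 0] by simp
    then have "v $ 0 \<noteq> 0"
      using v by (auto simp: vec_eq_iff)
    moreover have "(\<Sum>h\<in>UNIV. v $ h) = (\<Sum>h\<in>(UNIV :: 'g set). v $ 0)"
      by (intro sum.cong refl const)
    then have "of_nat CARD('g) * v $ 0 = (c + 1) * v $ 0"
      using sum[of 0] by auto
    ultimately show ?thesis
      by (simp add: eq_diff_eq)
  qed
  ultimately show ?thesis
    by blast
qed

text \<open>The two coordinates of the isomorphism evaluate \<open>f(A)\<close> at the eigenvalues: the row sum of
  \<open>f(A)\<close> is \<open>f(N - 1)\<close>, and a diagonal minus an off-diagonal entry is \<open>f(-1)\<close>.\<close>

lemma cay_spectral_complete_iso: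
  assumes N: "CARD('g::{finite,ab_group_add}) \<ge> 2" "(of_nat CARD('g::{finite,ab_group_add}) :: 'k::field) \<noteq> 0"
  shows "\<exists>\<phi>. is_iso_to_K2 \<phi> (cay_spectral (UNIV - {0}) :: ('k::field, 'g::{finite,ab_group_add}) sqmat set)"
proof -
  obtain a :: 'g where a: "a \<noteq> 0"
    using obtain_nonzero N(1) by blast
  define n :: 'k where "n = of_nat CARD('g)"
  define \<phi> :: "('k, 'g) sqmat \<Rightarrow> 'k^2"
    where "\<phi> X = (\<chi> i. if i = 1 then \<Sum>h\<in>UNIV. X $ 0 $ h else X $ 0 $ 0 - X $ 0 $ a)" for X
  define B where "B = (cay_spectral (UNIV - {0}) :: ('k, 'g) sqmat set)"
  define lc :: "'k \<Rightarrow> 'k \<Rightarrow> ('k, 'g) sqmat" where "lc x y = x *m mat 1 + y *m cay_complete" for x y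
  have B: "B = {lc x y | x y. True}"
    by (simp add: B_def cay_spectral_complete span_pair lc_def)
  have row: "(\<Sum>h\<in>UNIV. lc x y $ 0 $ h) = x + y * (n - 1)" for x y
  proof -
    have "(\<Sum>h\<in>UNIV. lc x y $ 0 $ h) = (\<Sum>h\<in>(UNIV :: 'g set). y + (if h = 0 then x - y else 0))"
      by (intro sum.cong) (auto simp: lc_def mat_def cay_complete_nth)
    then show ?thesis
      by (simp add: sum.distrib n_def algebra_simps)
  qed
  have \<phi>: "\<phi> (lc x y) = (\<chi> i. if i = 1 then x + y * (n - 1) else x - y)" for x y
    using a by (simp add: \<phi>_def row vec_eq_iff) (simp add: lc_def mat_def cay_complete_nth)
  have one: "mat 1 = lc 1 0"
    by (simp add: lc_def)
  have add: "lc x y + lc x' y' = lc (x + x') (y + y')" for x y x' y'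
    by (simp add: lc_def vec_eq_iff algebra_simps)
  have scale: "c *m lc x y = lc (c * x) (c * y)" for c x y
    by (simp add: lc_def vec_eq_iff algebra_simps)
  \<comment> \<open>The product rule is the relation
    \<open>A ** A = (n - 2) *m A + (n - 1) *m 1\<close> extended bilinearly.\<close>
  have mult: "lc x y ** lc x' y' = lc (x * x' + y * y' * (n - 1)) (x * y' + y * x' + y * y' * (n - 2))"
    for x y x' y'
    by (simp add: lc_def n_def matrix_add_ldistrib matrix_add_rdistrib mscale_matrix_mult_left
        mscale_matrix_mult_right cay_complete_square vec_eq_iff algebra_simps)
  have "bij_betw \<phi> B UNIV"
    unfolding bij_betw_def
  proof
    show "inj_on \<phi> B"
    proof
      fix X Y
      assume "X \<in> B" "Y \<in> B" and eq: "\<phi> X = \<phi> Y"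
      then obtain x y x' y' where XY: "X = lc x y" "Y = lc x' y'"
        unfolding B by blast
      from eq have "\<phi> X $ 1 = \<phi> Y $ 1" "\<phi> X $ 2 = \<phi> Y $ 2"
        by simp_all
      then have *: "x + y * (n - 1) = x' + y' * (n - 1)" "x - y = x' - y'"
        by (simp_all add: XY \<phi>)
      \<comment> \<open>The difference of the two coordinates of \<open>\<phi> (lc x y)\<close> is
        \<open>n * y\<close>, so injectivity rests on \<open>n\<close> being nonzero in
        \<open>K\<close>. If \<open>n\<close> were zero, the all-ones matrix \<open>lc 1 1\<close>
        would be sent to zero.\<close>
      then have "n * (y - y') = 0"
        by algebra
      with * show "X = Y"
        using N(2) by (simp add: XY n_def)
    qed
    have "w \<in> \<phi> ` B" for w :: "'k^2"
    proof -
      \<comment> \<open>The witness solves \<open>x + y * (n - 1) = w $ 1\<close> and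
        \<open>x - y = w $ 2\<close>: subtraction gives \<open>n * y\<close>, and then
        \<open>x = w $ 2 + y\<close>.\<close>
      define y where "y = (w $ 1 - w $ 2) / n"
      have "n * y = w $ 1 - w $ 2"
        using N(2) by (simp add: y_def n_def)
      then have "\<phi> (lc (w $ 2 + y) y) = w"
        by (simp add: \<phi> vec_eq_iff forall_2 algebra_simps)
      moreover have "lc (w $ 2 + y) y \<in> B"
        unfolding B by blast
      ultimately show ?thesis
        by (metis imageI)
    qed
    then show "\<phi> ` B = UNIV"
      by blast
  qed
  moreover have "\<phi> (mat 1) = 1"
    by (simp add: one \<phi> vec_eq_iff)
  moreover have "\<phi> (X + Y) = \<phi> X + \<phi> Y \<and> \<phi> (X ** Y) = \<phi> X * \<phi> Y" if XY: "X \<in> B" "Y \<in> B" for X Y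
  proof -
    from XY obtain x y x' y' where "X = lc x y" "Y = lc x' y'"
      unfolding B by blast
    then show ?thesis
      by (simp only: add mult \<phi>) (simp add: vec_eq_iff algebra_simps)
  qed
  moreover have "\<phi> (c *m X) = c *s \<phi> X" if X: "X \<in> B" for c X
  proof -
    from X obtain x y where "X = lc x y"
      unfolding B by blast
    then show ?thesis
      by (simp only: scale \<phi>) (simp add: vec_eq_iff algebra_simps)
  qed
  ultimately show ?thesis
    unfolding is_iso_to_K2_def B_def by blast
qed

section \<open>A single adjacency matrix does not generate the Bose-Mesner algebra\<close>

text \<open>\<open>esym gs k\<close> is the \<open>k\<close>-th elementary symmetric polynomial in the translations by the
  elements of the list \<open>gs\<close>.\<close>

fun esym :: "'g::{finite,ab_group_add} list \<Rightarrow> nat \<Rightarrow> ('k::field, 'g) sqmat" where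
  "esym gs 0 = mat 1"
| "esym [] (Suc k) = 0"
| "esym (g # gs) (Suc k) = esym gs (Suc k) + translation_mat g ** esym gs k"

lemma esym_eq_0: "length gs < k \<Longrightarrow> esym gs k = 0"
proof (induction gs k rule: esym.induct)
  case (3 g gs k)
  then show ?case
    by (simp add: vec_eq_iff matrix_matrix_mult_def)
qed auto

lemma esym_1: "esym gs (Suc 0) = (\<Sum>g\<leftarrow>gs. translation_mat g)"
  by (induction gs) (simp_all add: add.commute)

lemma translation_mat_commute_esym_1:
  "translation_mat g ** esym gs (Suc 0) = esym gs (Suc 0) ** translation_mat g"
proof (induction gs)
  case Nil
  then show ?case
    by (simp add: vec_eq_iff matrix_matrix_mult_def)
next
  case (Cons h gs)
  then show ?case
    by (simp add: matrix_add_ldistrib matrix_add_rdistrib translation_mat_mult add.commute)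
qed

text \<open>Multiplying a product of \<open>k + 1\<close> of the involutions by one more either adds
  a new factor or cancels one already present. A product of \<open>k + 2\<close> factors arises in
  \<open>k + 2\<close> ways, a product of \<open>k\<close> factors in \<open>m - k\<close> ways,
  where \<open>m = length gs\<close>. The index is shifted to avoid \<open>e_{-1}\<close>, and
  \<open>m - k\<close> is formed in the field because \<open>k\<close> may exceed
  \<open>m\<close>.\<close>

lemma esym_1_mult_esym:
  fixes gs :: "'g::{finite,ab_group_add} list"
  assumes invol: "\<And>g :: 'g. g + g = 0"
  shows "(esym gs (Suc 0) :: ('k::field, 'g) sqmat) ** esym gs (Suc k)
    = of_nat (k + 2) *m esym gs (Suc (Suc k)) + (of_nat (length gs) - of_nat k) *m esym gs k"
proof (induction gs arbitrary: k)
  case Nil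
  show ?case
    by (cases k) (simp_all add: vec_eq_iff matrix_matrix_mult_def)
next
  case (Cons g gs)
  let ?P = "translation_mat g :: ('k, 'g) sqmat"
  let ?A = "esym gs (Suc 0) :: ('k, 'g) sqmat"
  have P2: "?P ** (?P ** X) = X" for X :: "('k, 'g) sqmat"
    by (simp add: matrix_mul_assoc translation_mat_mult invol translation_mat_0)
  have AP: "?A ** (?P ** X) = ?P ** (?A ** X)" for X :: "('k, 'g) sqmat"
    by (metis matrix_mul_assoc translation_mat_commute_esym_1)
  show ?case
  proof (cases k)
    case 0
    then show ?thesis
      using Cons[of 0]
      by (simp add: matrix_add_ldistrib matrix_add_rdistrib translation_mat_mult
          invol translation_mat_0 translation_mat_commute_esym_1)
        (simp add: vec_eq_iff algebra_simps)
  next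
    case (Suc l)
    \<comment> \<open>Expand \<open>(A + P)(e_{k+1} + P e_k)\<close>, where \<open>P\<close>
      commutes with \<open>A\<close> and squares to the identity. The induction hypothesis then
      applies at \<open>k\<close> and at \<open>l = k - 1\<close>, hence the separate case
      \<open>k = 0\<close>.\<close>
    have "esym (g # gs) (Suc 0) ** esym (g # gs) (Suc k)
      = ?A ** esym gs (Suc k) + ?P ** (?A ** esym gs k) + ?P ** esym gs (Suc k) + esym gs k"
      by (simp add: matrix_add_ldistrib matrix_add_rdistrib AP P2 flip: matrix_mul_assoc)
    also have "\<dots> = of_nat (k + 2) *m esym (g # gs) (Suc (Suc k))
      + (of_nat (length (g # gs)) - of_nat k) *m esym (g # gs) k"
      unfolding Suc Cons
      by (simp only: esym.simps matrix_add_ldistrib mscale_matrix_mult_right)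
        (simp add: vec_eq_iff algebra_simps)
    finally show ?thesis .
  qed
qed

lemma cay_spectral_subset_span_esym:
  fixes S :: "'g::{finite,ab_group_add} set"
  assumes invol: "\<And>g :: 'g. g + g = 0"
  obtains W :: "('k::field, 'g) sqmat set"
  where "finite W" "card W \<le> Suc (card S)" "cay_spectral S \<subseteq> mat_space.span W"
proof -
  obtain gs where gs: "set gs = S" "distinct gs"
    using finite_distinct_list[of S] by auto
  then have len: "length gs = card S"
    using distinct_card by metis
  let ?W = "esym gs ` {..card S} :: ('k, 'g) sqmat set"
  have W: "finite ?W" "card ?W \<le> Suc (card S)"
    using card_image_le[of "{..card S}" "esym gs"] by simp_all
  \<comment> \<open>The recursion for \<open>A e_m\<close> reaches \<open>e_{m+1}\<close>, which is
    zero, so multiplication by \<open>A\<close> never leaves the span.\<close>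
  have mem: "esym gs k \<in> mat_space.span ?W" for k
    by (cases "k \<le> card S")
      (auto simp: esym_eq_0 len not_le intro: mat_space.span_base mat_space.span_zero)
  have adj: "cay_adj S = (esym gs (Suc 0) :: ('k, 'g) sqmat)"
    using gs by (simp add: cay_adj_eq_sum esym_1 sum_list_distinct_conv_sum_set)
  have "cay_adj S ** esym gs k \<in> mat_space.span ?W" for k
  proof (cases k)
    case 0
    then show ?thesis
      using mem[of "Suc 0"] by (simp add: adj)
  next
    case (Suc l)
    then show ?thesis
      by (simp only: adj esym_1_mult_esym[OF invol])
        (intro mat_space.span_add mat_space.span_scale mem)
  qed
  then have "cay_adj S ** Y \<in> mat_space.span ?W" if "Y \<in> mat_space.span ?W" for Y
    using matrix_mult_in_span[of ?W "cay_adj S" ?W Y] that by auto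
  then have "cay_spectral S \<subseteq> mat_space.span ?W"
    unfolding cay_spectral_def using mem[of 0] by (intro spectral_algebra_subset) auto
  with W show thesis
    by (rule that)
qed

section \<open>Strictness of the inclusion for at least three group elements\<close>

lemma cay_spectral_complete_psubset:
  assumes "CARD('g::{finite,ab_group_add}) \<ge> 3"
  shows "cay_spectral (UNIV - {0}) \<subset> (bose_mesner :: ('k::field, 'g::{finite,ab_group_add}) sqmat set)"
proof -
  have "card {mat 1, cay_complete :: ('k, 'g) sqmat} < CARD('g)"
    using assms card_insert_le_m1[of 2 "{cay_complete :: ('k, 'g) sqmat}" "mat 1"] by simp
  then have "\<not> bose_mesner \<subseteq> mat_space.span {mat 1, cay_complete :: ('k, 'g) sqmat}"
    by (intro bose_mesner_not_subset_span) auto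
  then show ?thesis
    using cay_spectral_subset_bose_mesner[of "UNIV - {0}"]
    by (auto simp: cay_spectral_complete)
qed

lemma cay_spectral_psubset:
  fixes S :: "'g::{finite,ab_group_add} set"
  assumes N: "CARD('g) \<ge> 3" and S: "S \<subseteq> UNIV - {0}" "S = uminus ` S"
  shows "cay_spectral S \<subset> (bose_mesner :: ('k::field, 'g) sqmat set)"
proof (cases "\<forall>g :: 'g. g + g = 0")
  case True
  show ?thesis
  proof (cases "S = UNIV - {0}")
    case True
    with cay_spectral_complete_psubset[OF N] show ?thesis
      by simp
  next
    \<comment> \<open>A proper subset of the \<open>N - 1\<close> nonzero elements has at most
      \<open>N - 2\<close> elements, so the \<open>m + 1\<close> spanning matrices are fewer than
      \<open>N\<close>.\<close>
    case False
    with S have "card S < card (UNIV - {0 :: 'g})"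
      by (intro psubset_card_mono) auto
    then have "Suc (card S) < CARD('g)"
      by (simp add: card_Diff_singleton)
    moreover obtain W :: "('k, 'g) sqmat set" where
      W: "finite W" "card W \<le> Suc (card S)" "cay_spectral S \<subseteq> mat_space.span W"
      using cay_spectral_subset_span_esym \<open>\<forall>g :: 'g. g + g = 0\<close> by metis
    ultimately have "\<not> bose_mesner \<subseteq> mat_space.span W"
      by (intro bose_mesner_not_subset_span) auto
    with W(3) show ?thesis
      using cay_spectral_subset_bose_mesner[of S] by blast
  qed
next
  case False
  then obtain g :: 'g where g: "g + g \<noteq> 0"
    by blast
  have "h - g \<in> S \<longleftrightarrow> g - h \<in> S" for g h
    by (metis S(2) image_eqI minus_diff_eq)
  then have "transpose (cay_adj S :: ('k, 'g) sqmat) = cay_adj S"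
    by (simp add: transpose_def cay_adj_def vec_eq_iff)
  \<comment> \<open>The entry at \<open>(0, g)\<close> of \<open>translation_mat g\<close> is
    \<open>1\<close>, whereas the entry at \<open>(g, 0)\<close> is \<open>1\<close> only if
    \<open>g + g = 0\<close>.\<close>
  moreover have "transpose (translation_mat g :: ('k, 'g) sqmat) $ 0 $ g
    \<noteq> translation_mat g $ 0 $ g"
    using g by (simp add: transpose_def translation_mat_def)
  ultimately have "(translation_mat g :: ('k, 'g) sqmat) \<notin> cay_spectral S"
    unfolding cay_spectral_def using spectral_algebra_symmetric by metis
  moreover have "(translation_mat g :: ('k, 'g) sqmat) \<in> bose_mesner"
    unfolding bose_mesner_eq_span by (auto intro: mat_space.span_base)
  ultimately show ?thesis
    using cay_spectral_subset_bose_mesner[of S] by blast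
qed

theorem proposition12p1:
  fixes S :: "'g::{finite,ab_group_add} set"
    and N :: nat
  assumes order_N: "N = CARD('g)"
    and S_nonzero: "S \<subseteq> UNIV - {0}"
    and S_symmetric: "S = uminus ` S"
  shows
    "\<comment> \<open>the spectral algebra is a subalgebra of the Bose-Mesner algebra\<close>
     (cay_adj S :: ('k::field, 'g) sqmat)
       = (\<Sum>s\<in>S. translation_mat s) \<and>
     (cay_adj S :: ('k, 'g) sqmat) \<in> bose_mesner \<and>
     cay_spectral S \<subseteq> (bose_mesner :: ('k, 'g) sqmat set) \<and>
     is_subalgebra (cay_spectral S :: ('k, 'g) sqmat set) \<and>
     \<comment> \<open>the complete Cayley graph\<close>
     (N \<ge> 2 \<longrightarrow>
       {c. mat_eigenvalue (cay_adj (UNIV - {0}) :: ('k, 'g) sqmat) c}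
         = {of_nat N - 1, -1}) \<and>
     ((of_nat N :: 'k) \<noteq> 0 \<longrightarrow> (of_nat N - 1 :: 'k) \<noteq> -1) \<and>
     (N \<ge> 2 \<and> (of_nat N :: 'k) \<noteq> 0 \<longrightarrow>
       (\<exists>\<phi>. is_iso_to_K2 \<phi>
         (cay_spectral (UNIV - {0}) :: ('k, 'g) sqmat set))) \<and>
     (N \<ge> 2 \<longrightarrow>
       mat_space.dim (cay_spectral (UNIV - {0}) :: ('k, 'g) sqmat set) = 2) \<and>
     mat_space.dim (bose_mesner :: ('k, 'g) sqmat set) = N \<and>
     (N \<ge> 3 \<longrightarrow>
       cay_spectral (UNIV - {0}) \<subset> (bose_mesner :: ('k, 'g) sqmat set)) \<and>
     \<comment> \<open>all translation matrices are needed, and one adjacency matrix does not generate\<close>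
     inj (translation_mat :: 'g \<Rightarrow> ('k, 'g) sqmat) \<and>
     mat_space.span (range translation_mat)
       = (bose_mesner :: ('k, 'g) sqmat set) \<and>
     (\<forall>T. T \<subset> UNIV \<longrightarrow> mat_space.span (translation_mat ` T)
       \<noteq> (bose_mesner :: ('k, 'g) sqmat set)) \<and>
     (N \<ge> 3 \<longrightarrow>
       cay_spectral S \<subset> (bose_mesner :: ('k, 'g) sqmat set))"
proof -
  have "mat_space.span (translation_mat ` T) \<noteq> (bose_mesner :: ('k, 'g) sqmat set)"
    if "T \<subset> UNIV" for T :: "'g set"
  proof -
    from that obtain g where "g \<notin> T"
      by blast
    then have "(translation_mat g :: ('k, 'g) sqmat) \<notin> mat_space.span (translation_mat ` T)"
      by (simp add: translation_mat_in_span_iff)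
    moreover have "(translation_mat g :: ('k, 'g) sqmat) \<in> bose_mesner"
      unfolding bose_mesner_eq_span by (auto intro: mat_space.span_base)
    ultimately show ?thesis
      by blast
  qed
  moreover have "is_subalgebra (cay_spectral S :: ('k, 'g) sqmat set)"
    by (simp add: cay_spectral_def is_subalgebra_spectral_algebra)
  moreover have "mat_space.dim (bose_mesner :: ('k, 'g) sqmat set) = N"
    by (simp add: bose_mesner_eq_span order_N card_range_translation_mat
        mat_space.dim_eq_card_independent independent_translation_mat)
  moreover have "cay_spectral S \<subset> (bose_mesner :: ('k, 'g) sqmat set)" if "N \<ge> 3"
    using that S_nonzero S_symmetric unfolding order_N by (rule cay_spectral_psubset)
  ultimately show ?thesis
    unfolding order_N
    by (simp add: cay_adj_eq_sum[symmetric] cay_adj_in_bose_mesner cay_spectral_subset_bose_mesner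
        mat_eigenvalue_cay_complete cay_spectral_complete_iso dim_cay_spectral_complete
        cay_spectral_complete_psubset inj_translation_mat bose_mesner_eq_span[symmetric])
qed

end
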